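(* Let $\mathcal{F}\subset\binom{[n]}{k}$ be an intersecting family with $n>36k$. (1) If $|\mathcal{F}|\geq|\mathcal{F}_3|+1$, then \[ \varrho(\mathcal{F})>1-\max\{k+4,40\}\cdot\frac{k}{3n}. \] (2) If $|\mathcal{F}|\geq|\mathcal{F}_3|+\frac{d}{2}\binom{n-d+3}{k-d+3}$ for some integer $d\geq 40$, then \[ \varrho(\mathcal{F})>1-\frac{dk}{3n}. \]
   Context: $[n]=\{1,\ldots,n\}$, $k\geq 2$, and $\binom{[n]}{k}$ is the collection of all $k$-element subsets of $[n]$. A family $\mathcal{F}\subset\binom{[n]}{k}$ is intersecting if $F\cap F'\neq\emptyset$ for all $F,F'\in\mathcal{F}$. For $x\in[n]$, $\mathcal{F}(x)=\{F\setminus\{x\}\colon x\in F\in\mathcal{F}\}$; $\Delta(\mathcal{F})=\max_{1\leq x\leq n}|\mathcal{F}(x)|$ is the maximum degree, and $\varrho(\mathcal{F})=\Delta(\mathcal{F})/|\mathcal{F}|$. The family $\mathcal{F}_3=\mathcal{F}_3(n,k)$ is \[ \mathcal{F}_3=\left\{F\in\binom{[n]}{k}\colon 1\in F,\ F\cap\{2,3\}\neq\emptyset\right\}\cup\left\{F\in\binom{[n]}{k}\colon \{2,3\}\subset F\right\}. \] A binomial coefficient with negative lower entry is $0$; in particular $\binom{n-d+3}{k-d+3}=0$ when $d\geq k+4$.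
   Formalization: In part (2) the hypothesis |F| > |F_3| is added; it is automatic for d ≤ k+3, but for d ≥ k+4 the binomial coefficient is 0 and F = F_3 would be allowed, where the claim fails (k=2, n=81, d=40: ratio 2/3 < 163/243). *)

theory Defs
  imports Complex_Main "HOL-Library.Ramsey"
begin

definition intersecting :: "'a set set \<Rightarrow> bool" where
  "intersecting \<F> \<longleftrightarrow> (\<forall>A\<in>\<F>. \<forall>B\<in>\<F>. A \<inter> B \<noteq> {})"

definition link :: "'a set set \<Rightarrow> 'a \<Rightarrow> 'a set set" where
  "link \<F> x = {A - {x} | A. A \<in> \<F> \<and> x \<in> A}"

text \<open>Only meaningful for a positive ground set size \<open>n\<close>: the maximum ranges over \<open>{1..n}\<close>.\<close>

definition max_degree :: "nat \<Rightarrow> nat set set \<Rightarrow> nat" where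
  "max_degree n \<F> = Max ((\<lambda>x. card (link \<F> x)) ` {1..n})"

definition degree_ratio :: "nat \<Rightarrow> nat set set \<Rightarrow> real" where
  "degree_ratio n \<F> = real (max_degree n \<F>) / real (card \<F>)"

definition F3 :: "nat \<Rightarrow> nat \<Rightarrow> nat set set" where
  "F3 n k = {A \<in> nsets {1..n} k. 1 \<in> A \<and> A \<inter> {2, 3} \<noteq> {}}
          \<union> {A \<in> nsets {1..n} k. {2, 3} \<subseteq> A}"

text \<open>Binomial coefficient with integer entries, \<open>0\<close> if the lower entry is negative.
  Truncated subtraction on \<^typ>\<open>nat\<close> would instead turn a negative lower entry into \<open>0\<close>
  and the coefficient into \<open>1\<close>.\<close>

definition binom :: "int \<Rightarrow> int \<Rightarrow> real" where
  "binom a b = (if b < 0 then 0 else real_of_int a gchoose nat b)"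

text \<open>In the second part of the theorem the size hypothesis is accompanied by
  \<open>card \<F> > card (F3 n k)\<close>. This follows from the size hypothesis when \<open>d \<le> k + 3\<close>, since
  the binomial coefficient is then positive. For \<open>d \<ge> k + 4\<close> the coefficient vanishes and
  \<open>\<F> = F3 n k\<close> has to be excluded: for \<open>k = 2\<close>, \<open>n = 81\<close>, \<open>d = 40\<close> it has degree ratio
  \<open>2/3 < 163/243 = 1 - d * k / (3 * n)\<close>.\<close>

end

theory Submission
  imports Defs "HOL-Combinatorics.Transposition"
begin

text \<open>Put \<open>e = (n-3 choose k-3)\<close> and \<open>m = (n-3 choose k-2)\<close>, so that \<open>F3\<close> has \<open>3m + e\<close> members
  when \<open>k \<ge> 3\<close>. If \<open>\<F>\<close> is larger than that, some point is missed by at most \<open>4e\<close> members, and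
  \<open>4e / (3m)\<close> is well below \<open>40k / (3n)\<close>.

  Read sets as walks, going up at their elements and down elsewhere. Split a shifted family by the
  traces of its members on \<open>{1,2,3}\<close> and pair complementary traces: a reflection shows that the
  two slices of a pair together are no larger than one full slice, as soon as all walks in one of
  them reach the right height. The four pairs sum up to \<open>3m + e\<close>. The height condition can fail
  only for the pair of traces \<open>{1}\<close> and \<open>{2,3}\<close>, and then at most \<open>4e\<close> members miss \<open>1\<close>.

  For arbitrary families, shifting on \<open>{2..n}\<close> alone keeps the number of members that miss \<open>1\<close>
  and shows that it is at most \<open>4e\<close> or greater than \<open>m\<close>. If shifting completely from a
  counterexample passes from the second kind to the first, then it does so in one step
  \<open>j \<mapsto> i\<close>; just before it at most \<open>4e\<close> members miss both \<open>i\<close> and \<open>j\<close>, although more than \<open>m\<close>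
  miss either point, and pairing the traces on \<open>i, j\<close> and one further point bounds the family by
  \<open>3m + e\<close> again.\<close>

section \<open>Shifting families of sets\<close>

text \<open>The Erdos-Ko-Rado shift of a single member. A set stays put when its image is already a
  member, which keeps the operation injective on \<open>\<F>\<close>.\<close>

definition shift_set :: "nat \<Rightarrow> nat \<Rightarrow> nat set set \<Rightarrow> nat set \<Rightarrow> nat set" where
  "shift_set i j \<F> A =
    (if j \<in> A \<and> i \<notin> A \<and> insert i (A - {j}) \<notin> \<F> then insert i (A - {j}) else A)"

definition shift :: "nat \<Rightarrow> nat \<Rightarrow> nat set set \<Rightarrow> nat set set" where
  "shift i j \<F> = shift_set i j \<F> ` \<F>"

text \<open>The parameter \<open>s\<close> leaves smaller points alone, so that counts by the trace
  on \<open>{..<s}\<close> survive the passage to a stable family.\<close>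

definition stable :: "nat \<Rightarrow> nat set set \<Rightarrow> bool" where
  "stable s \<F> \<longleftrightarrow>
    (\<forall>A\<in>\<F>. \<forall>i j. s \<le> i \<longrightarrow> i < j \<longrightarrow> j \<in> A \<longrightarrow> i \<notin> A \<longrightarrow> insert i (A - {j}) \<in> \<F>)"

lemma shift_set_fixed: "shift_set i j \<F> A \<in> \<F> \<Longrightarrow> shift_set i j \<F> A = A"
  by (auto simp: shift_set_def split: if_splits)

lemma shift_set_moved:
  assumes "A \<in> \<F>" "shift_set i j \<F> A \<notin> \<F>"
  shows "j \<in> A" "i \<notin> A" "shift_set i j \<F> A = insert i (A - {j})"
  using assms by (simp_all add: shift_set_def split: if_splits)

text \<open>Moved sets land outside \<open>\<F>\<close> and fixed ones inside, so the two kinds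
  never collide; a moved set is recovered by putting \<open>j\<close> back in place of
  \<open>i\<close>.\<close>

lemma inj_on_shift_set: "inj_on (shift_set i j \<F>) \<F>"
proof (rule inj_onI)
  fix A B assume AB: "A \<in> \<F>" "B \<in> \<F>" "shift_set i j \<F> A = shift_set i j \<F> B"
  show "A = B"
  proof (cases "shift_set i j \<F> A \<in> \<F>")
    case True
    then have "shift_set i j \<F> A = A" by (rule shift_set_fixed)
    moreover have "shift_set i j \<F> B = B"
      using True unfolding AB(3) by (rule shift_set_fixed)
    ultimately show ?thesis using AB(3) by metis
  next
    case False
    then have "shift_set i j \<F> B \<notin> \<F>" using AB(3) by simp
    note A = shift_set_moved[OF AB(1) False] and B = shift_set_moved[OF AB(2) this]
    have "A = insert j (insert i (A - {j}) - {i})" using A(1,2) by auto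
    also have "\<dots> = insert j (insert i (B - {j}) - {i})"
      using AB(3) unfolding A(3) B(3) by (rule arg_cong)
    also have "\<dots> = B" using B(1,2) by auto
    finally show ?thesis .
  qed
qed

lemma card_shift_Collect:
  assumes "\<And>A. A \<in> \<F> \<Longrightarrow> P (shift_set i j \<F> A) \<longleftrightarrow> Q A"
  shows "card {A \<in> shift i j \<F>. P A} = card {A \<in> \<F>. Q A}"
proof -
  have "{A \<in> shift i j \<F>. P A} = shift_set i j \<F> ` {A \<in> \<F>. Q A}"
    using assms by (auto simp: shift_def)
  moreover have "inj_on (shift_set i j \<F>) {A \<in> \<F>. Q A}"
    using inj_on_shift_set by (rule inj_on_subset) auto
  ultimately show ?thesis by (simp add: card_image)
qed

lemma card_shift: "card (shift i j \<F>) = card \<F>"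
  unfolding shift_def by (rule card_image[OF inj_on_shift_set])

lemma shift_subset_nsets:
  assumes "\<F> \<subseteq> nsets {1..n} k" "1 \<le> i" "i < j"
  shows "shift i j \<F> \<subseteq> nsets {1..n} k"
proof -
  have "shift_set i j \<F> A \<in> nsets {1..n} k" if "A \<in> \<F>" for A
  proof -
    have A: "A \<subseteq> {1..n}" "finite A" "card A = k" using assms(1) that by (auto simp: nsets_def)
    show ?thesis
    proof (cases "j \<in> A \<and> i \<notin> A \<and> insert i (A - {j}) \<notin> \<F>")
      case True
      then have "i \<le> n" using A assms by auto
      moreover have "card (insert i (A - {j})) = k"
        using True A by (metis DiffD1 card_Suc_Diff1 card_insert_disjoint finite_Diff)
      ultimately show ?thesis using True A assms by (auto simp: shift_set_def nsets_def)
    next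
      case False
      then have "shift_set i j \<F> A = A" unfolding shift_set_def by (rule if_not_P)
      then show ?thesis using assms(1) that by auto
    qed
  qed
  then show ?thesis by (auto simp: shift_def)
qed

text \<open>Two moved sets share \<open>i\<close>, and two sets that lie in \<open>\<F>\<close> meet
  already. What remains is a moved \<open>A\<close> against an unmoved \<open>B\<close>.\<close>

lemma intersecting_shift:
  assumes "intersecting \<F>"
  shows "intersecting (shift i j \<F>)"
proof -
  let ?c = "shift_set i j \<F>"
  have mixed: "?c A \<inter> ?c B \<noteq> {}"
    if AB: "A \<in> \<F>" "B \<in> \<F>" and A: "?c A \<notin> \<F>" and B: "?c B \<in> \<F>" for A B
  proof
    assume e: "?c A \<inter> ?c B = {}"
    note m = shift_set_moved[OF AB(1) A]
    have b: "?c B = B" using B by (rule shift_set_fixed)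
    have "A \<inter> B \<noteq> {}" using assms AB by (auto simp: intersecting_def)
    then have jB: "j \<in> B" and iB: "i \<notin> B" using e m b by auto
    \<comment> \<open>\<open>B\<close> could move but did not, so its image was a member all along;
      that member turns out to be disjoint from \<open>A\<close>.\<close>
    have "insert i (B - {j}) \<in> \<F>"
    proof (rule ccontr)
      assume "insert i (B - {j}) \<notin> \<F>"
      then have "?c B = insert i (B - {j})" using jB iB unfolding shift_set_def by simp
      then show False using b iB by auto
    qed
    then have "A \<inter> insert i (B - {j}) \<noteq> {}"
      using assms AB(1) unfolding intersecting_def by blast
    then show False using e m b by auto
  qed
  have "?c A \<inter> ?c B \<noteq> {}" if AB: "A \<in> \<F>" "B \<in> \<F>" for A B
  proof (cases "?c A \<in> \<F>")
    case True
    show ?thesis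
    proof (cases "?c B \<in> \<F>")
      case True
      then show ?thesis using \<open>?c A \<in> \<F>\<close> assms by (auto simp: intersecting_def)
    next
      case False
      then show ?thesis using mixed[of B A] AB True by auto
    qed
  next
    case False
    show ?thesis
    proof (cases "?c B \<in> \<F>")
      case True
      then show ?thesis using mixed AB False by auto
    next
      case F: False
      have "i \<in> ?c A" "i \<in> ?c B" 
        using shift_set_moved(3)[OF AB(1) False] shift_set_moved(3)[OF AB(2) F] by auto
      then show ?thesis by auto
    qed
  qed
  then show ?thesis by (auto simp: intersecting_def shift_def)
qed

lemma subset_nsetsD:
  "\<F> \<subseteq> nsets {1..n::nat} k \<Longrightarrow> A \<in> \<F> \<Longrightarrow> A \<subseteq> {1..n} \<and> finite A \<and> card A = k"
  by (auto simp: nsets_def)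

lemma finite_family: "\<F> \<subseteq> nsets {1..n::nat} k \<Longrightarrow> finite \<F>"
  by (meson finite_atLeastAtMost finite_imp_finite_nsets finite_subset)

text \<open>The potential that makes repeated shifting terminate.\<close>

lemma sum_shift_less:
  assumes F: "\<F> \<subseteq> nsets {1..n} k" and "i < j"
    and A: "A \<in> \<F>" "j \<in> A" "i \<notin> A" "insert i (A - {j}) \<notin> \<F>"
  shows "(\<Sum>A\<in>shift i j \<F>. \<Sum>A) < (\<Sum>A\<in>\<F>. \<Sum>A)"
proof -
  have less: "\<Sum>(insert i (B - {j})) < \<Sum>B" if "B \<in> \<F>" "j \<in> B" "i \<notin> B" for B
  proof -
    have "finite B" using that F by (auto simp: nsets_def)
    then have "\<Sum>B = j + \<Sum>(B - {j})" "\<Sum>(insert i (B - {j})) = i + \<Sum>(B - {j})"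
      using that by (auto simp: sum.remove)
    then show ?thesis using \<open>i < j\<close> by simp
  qed
  have "(\<Sum>A\<in>shift i j \<F>. \<Sum>A) = (\<Sum>A\<in>\<F>. \<Sum>(shift_set i j \<F> A))"
    unfolding shift_def by (simp add: sum.reindex[OF inj_on_shift_set])
  also have "\<dots> < (\<Sum>A\<in>\<F>. \<Sum>A)"
  proof (rule sum_strict_mono_ex1[OF finite_family[OF F]])
    show "\<forall>x\<in>\<F>. \<Sum>(shift_set i j \<F> x) \<le> \<Sum>x"
      using less unfolding shift_set_def by (auto intro: less_imp_le)
    show "\<exists>a\<in>\<F>. \<Sum>(shift_set i j \<F> a) < \<Sum>a"
      using less[OF A(1-3)] A unfolding shift_set_def by auto
  qed
  finally show ?thesis .
qed

text \<open>Shift as long as some shift with \<open>s \<le> i < j\<close> has an effect. Such shifts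
  do not touch \<open>A \<inter> {..<s}\<close>, so every count by trace is preserved.\<close>

lemma ex_stable:
  assumes "\<F> \<subseteq> nsets {1..n} k" "intersecting \<F>" "1 \<le> s"
  shows "\<exists>\<G>. \<G> \<subseteq> nsets {1..n} k \<and> intersecting \<G> \<and> stable s \<G> \<and>
    (\<forall>L. card {A \<in> \<G>. A \<inter> {..<s} = L} = card {A \<in> \<F>. A \<inter> {..<s} = L})"
  using assms(1,2)
proof (induction "\<Sum>A\<in>\<F>. \<Sum>A" arbitrary: \<F> rule: less_induct)
  case less
  show ?case
  proof (cases "stable s \<F>")
    case True
    then show ?thesis using less.prems by blast
  next
    case False
    then obtain A i j where A: "A \<in> \<F>" "j \<in> A" "i \<notin> A" "insert i (A - {j}) \<notin> \<F>"
      and ij: "s \<le> i" "i < j"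
      unfolding stable_def by blast
    let ?G = "shift i j \<F>"
    have "\<exists>\<G>. \<G> \<subseteq> nsets {1..n} k \<and> intersecting \<G> \<and> stable s \<G> \<and>
      (\<forall>L. card {A \<in> \<G>. A \<inter> {..<s} = L} = card {A \<in> ?G. A \<inter> {..<s} = L})"
      using less.hyps[of ?G] sum_shift_less[OF less.prems(1) ij(2) A]
        shift_subset_nsets[OF less.prems(1)] intersecting_shift[OF less.prems(2)] ij assms(3)
      by auto
    moreover have "card {A \<in> ?G. A \<inter> {..<s} = L} = card {A \<in> \<F>. A \<inter> {..<s} = L}" for L
    proof (rule card_shift_Collect)
      fix A
      have "shift_set i j \<F> A \<inter> {..<s} = A \<inter> {..<s}" using ij by (auto simp: shift_set_def)
      then show "shift_set i j \<F> A \<inter> {..<s} = L \<longleftrightarrow> A \<inter> {..<s} = L" by simp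
    qed
    ultimately show ?thesis by auto
  qed
qed

section \<open>Walks of sets and disjointness in stable families\<close>

text \<open>The walks of \<open>x\<close> and \<open>y\<close> on \<open>{s..}\<close> have positive total height at some point. For members of
  a stable family this is what remains of intersecting after all shifts.\<close>

definition meets :: "nat \<Rightarrow> nat set \<Rightarrow> nat set \<Rightarrow> bool" where
  "meets s x y \<longleftrightarrow> (\<exists>u\<ge>s. card (x \<inter> {s..<u}) + card (y \<inter> {s..<u}) > u - s)"

text \<open>The walk of \<open>y\<close> on \<open>{s..}\<close> reaches height \<open>r\<close>.\<close>

definition hits :: "nat \<Rightarrow> nat \<Rightarrow> nat set \<Rightarrow> bool" where
  "hits s r y \<longleftrightarrow> (\<exists>u\<ge>s. u - s + r \<le> 2 * card (y \<inter> {s..<u}))"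

lemma card_Int_split:
  fixes s t u :: nat
  assumes "s \<le> t" "t \<le> u"
  shows "card (y \<inter> {s..<u}) = card (y \<inter> {s..<t}) + card (y \<inter> {t..<u})"
proof -
  have "y \<inter> {s..<u} = (y \<inter> {s..<t}) \<union> (y \<inter> {t..<u})" using assms by auto
  moreover have "(y \<inter> {s..<t}) \<inter> (y \<inter> {t..<u}) = {}" by auto
  ultimately show ?thesis by (simp add: card_Un_disjoint)
qed

text \<open>The least common element \<open>x\<close> can be moved in \<open>A\<close> to a smaller
  point \<open>y\<close> outside both sets. This stays in the family, removes \<open>x\<close> from
  the intersection and creates no meeting of the walks, so induction on the size of the intersection
  applies.\<close>

lemma stable_imp_disjoint:
  assumes st: "stable s \<F>" and "A \<in> \<F>" "finite (A \<inter> B)" "A \<inter> B \<inter> {..<s} = {}" "\<not> meets s A B"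
  shows "\<exists>A'\<in>\<F>. A' \<inter> B = {}"
  using assms(2-)
proof (induction "card (A \<inter> B)" arbitrary: A)
  case 0
  then show ?case by auto
next
  case (Suc c)
  define x where "x = Min (A \<inter> B)"
  have ne: "A \<inter> B \<noteq> {}" using Suc.hyps(2) by auto
  have x: "x \<in> A" "x \<in> B" using Min_in[OF Suc.prems(2) ne] by (auto simp: x_def)
  have xmin: "x \<le> z" if "z \<in> A" "z \<in> B" for z using that Suc.prems(2) by (auto simp: x_def)
  have sx: "s \<le> x" using x Suc.prems(3) by (metis Int_iff emptyE lessThan_iff not_le_imp_less)
  have le: "card (A \<inter> {s..<u}) + card (B \<inter> {s..<u}) \<le> u - s" if "s \<le> u" for u
    using Suc.prems(4) that unfolding meets_def by force
  have "\<exists>y. s \<le> y \<and> y < x \<and> y \<notin> A \<and> y \<notin> B"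
  proof (rule ccontr)
    assume "\<not> ?thesis"
    \<comment> \<open>If every point before \<open>x\<close> were covered, then \<open>x\<close>,
      which counts twice, would push the total at \<open>Suc x\<close> above its length.\<close>
    then have "{s..<x} \<subseteq> (A \<inter> {s..<x}) \<union> (B \<inter> {s..<x})" by auto
    then have "x - s \<le> card (A \<inter> {s..<x}) + card (B \<inter> {s..<x})"
      by (metis card_Un_le card_atLeastLessThan card_mono finite_Int finite_Un finite_atLeastLessThan
          le_trans)
    moreover have "card (A \<inter> {x..<Suc x}) = 1" "card (B \<inter> {x..<Suc x}) = 1" using x by auto
    ultimately show False
      using le[of "Suc x"] sx card_Int_split[of s x "Suc x" A] card_Int_split[of s x "Suc x" B] by simp
  qed
  then obtain y where y: "s \<le> y" "y < x" "y \<notin> A" "y \<notin> B" by blast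
  define A' where "A' = insert y (A - {x})"
  have A'F: "A' \<in> \<F>" using st Suc.prems(1) y x unfolding stable_def A'_def by blast
  have int: "A' \<inter> B = A \<inter> B - {x}" using y by (auto simp: A'_def)
  have "\<not> meets s A' B"
  proof
    assume "meets s A' B"
    then obtain u where u: "s \<le> u" "card (A' \<inter> {s..<u}) + card (B \<inter> {s..<u}) > u - s"
      unfolding meets_def by blast
    \<comment> \<open>Before \<open>y\<close> nothing has changed; between \<open>y\<close> and
      \<open>x\<close> the two sets are still disjoint; beyond \<open>x\<close> the number of
      elements is the old one.\<close>
    consider "u \<le> y" | "y < u" "u \<le> x" | "x < u" by linarith
    then show False
    proof cases
      case 1
      then have "A' \<inter> {s..<u} = A \<inter> {s..<u}" using y by (auto simp: A'_def)
      then show False using u le[of u] by simp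
    next
      case 2
      have "(A' \<inter> {s..<u}) \<inter> (B \<inter> {s..<u}) = {}" using 2 xmin y by (fastforce simp: A'_def)
      then have "card (A' \<inter> {s..<u}) + card (B \<inter> {s..<u}) = card ((A' \<inter> {s..<u}) \<union> (B \<inter> {s..<u}))"
        by (simp add: card_Un_disjoint)
      also have "\<dots> \<le> card {s..<u}" by (rule card_mono) auto
      finally show False using u by simp
    next
      case 3
      have "A' \<inter> {s..<u} = insert y ((A \<inter> {s..<u}) - {x})" using y 3 by (auto simp: A'_def)
      moreover have "x \<in> A \<inter> {s..<u}" using x sx 3 by auto
      ultimately have "card (A' \<inter> {s..<u}) = card (A \<inter> {s..<u})" using y
        by (metis DiffD1 IntD1 card_Suc_Diff1 card_insert_disjoint finite_Diff finite_Int finite_atLeastLessThan)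
      then show False using u le[of u] by simp
    qed
  qed
  moreover have "c = card (A' \<inter> B)" using int Suc.hyps(2) x Suc.prems(2) by simp
  moreover have "finite (A' \<inter> B)" "A' \<inter> B \<inter> {..<s} = {}" using int Suc.prems by auto
  ultimately show ?case using Suc.hyps(1) A'F by blast
qed

section \<open>Reflection of walks\<close>

text \<open>A finite set descends in the end, so there is a last point \<open>t\<close> with height
  at least \<open>r\<close>. One further step already falls below, which forces the height at
  \<open>t\<close> to be exactly \<open>r\<close>.\<close>

lemma last_hit:
  assumes "finite y" "hits s r y"
  shows "\<exists>t\<ge>s. 2 * card (y \<inter> {s..<t}) = t - s + r \<and> (\<forall>u>t. 2 * card (y \<inter> {t..<u}) < u - t)"
proof -
  define U where "U = {u. s \<le> u \<and> u - s + r \<le> 2 * card (y \<inter> {s..<u})}"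
  define t where "t = Max U"
  have "u \<le> s + 2 * card y" if "u \<in> U" for u
  proof -
    have "card (y \<inter> {s..<u}) \<le> card y" using assms(1) by (simp add: card_mono)
    then show ?thesis using that unfolding U_def mem_Collect_eq by linarith
  qed
  then have fin: "finite U" by (meson atMost_iff finite_atMost finite_subset subsetI)
  have "U \<noteq> {}" using assms(2) by (auto simp: hits_def U_def)
  then have tU: "t \<in> U" using fin by (simp add: t_def)
  have max: "u \<notin> U" if "t < u" for u using that Max_ge[OF fin] unfolding t_def by (meson leD)
  have st: "s \<le> t" using tU by (simp add: U_def)
  have "card (y \<inter> {s..<t}) \<le> card (y \<inter> {s..<Suc t})" by (rule card_mono) auto
  then have eq: "2 * card (y \<inter> {s..<t}) = t - s + r" 
    using max[OF lessI] tU st unfolding U_def mem_Collect_eq by linarith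
  have "2 * card (y \<inter> {t..<u}) < u - t" if "u > t" for u
    using max[OF that] that st eq card_Int_split[of s t u y] by (simp add: U_def)
  then show ?thesis using st eq by blast
qed

text \<open>Ups and downs are swapped before \<open>t\<close>, which mirrors the walk there; the
  steps from \<open>t\<close> on are kept.\<close>

definition reflect :: "nat \<Rightarrow> nat \<Rightarrow> nat set \<Rightarrow> nat set" where
  "reflect s t y = ({s..<t} - y) \<union> (y \<inter> {t..})"

lemma card_reflect_before:
  assumes "s \<le> u" "u \<le> t"
  shows "card (reflect s t y \<inter> {s..<u}) + card (y \<inter> {s..<u}) = u - s"
proof -
  have "(reflect s t y \<inter> {s..<u}) \<union> (y \<inter> {s..<u}) = {s..<u}"
    "(reflect s t y \<inter> {s..<u}) \<inter> (y \<inter> {s..<u}) = {}"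
    using assms by (auto simp: reflect_def)
  then show ?thesis by (metis card_Un_disjoint card_atLeastLessThan finite_Int finite_atLeastLessThan)
qed

lemma reflect_after: "t \<le> v \<Longrightarrow> reflect s t y \<inter> {v..<u} = y \<inter> {v..<u}"
  by (auto simp: reflect_def)

text \<open>The point where \<open>y\<close> meets height \<open>r\<close> for the last time is also the last point where the
  reflected walk meets height \<open>-r\<close>; this makes the reflection injective, and being below
  height \<open>r\<close> afterwards is what prevents it from meeting \<open>y\<close>.\<close>

lemma reflection:
  assumes Y: "Y \<subseteq> nsets {s..n} b" "\<And>y. y \<in> Y \<Longrightarrow> hits s r y" and "2 * b + s \<le> n + 1 + r"
  shows "\<exists>f. inj_on f Y \<and> f ` Y \<subseteq> nsets {s..n} (b - r) \<and> (\<forall>y\<in>Y. \<not> meets s (f y) y)"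
proof -
  have fin: "finite y" if "y \<in> Y" for y using that Y(1) by (auto simp: nsets_def)
  have "\<exists>t. \<forall>y\<in>Y. s \<le> t y \<and> 2 * card (y \<inter> {s..<t y}) = t y - s + r \<and>
      (\<forall>u>t y. 2 * card (y \<inter> {t y..<u}) < u - t y)"
    using last_hit fin Y(2) by (intro bchoice) blast
  then obtain t where t: "\<And>y. y \<in> Y \<Longrightarrow> s \<le> t y"
      "\<And>y. y \<in> Y \<Longrightarrow> 2 * card (y \<inter> {s..<t y}) = t y - s + r"
      "\<And>y u. y \<in> Y \<Longrightarrow> u > t y \<Longrightarrow> 2 * card (y \<inter> {t y..<u}) < u - t y"
    by blast
  define f where "f y = reflect s (t y) y" for y
  have bef: "card (f y \<inter> {s..<u}) + card (y \<inter> {s..<u}) = u - s" if "s \<le> u" "u \<le> t y" for y u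
    unfolding f_def by (rule card_reflect_before[OF that])
  have aft: "f y \<inter> {v..<u} = y \<inter> {v..<u}" if "t y \<le> v" for y u v
    unfolding f_def by (rule reflect_after[OF that])
  have nm: "\<not> meets s (f y) y" if y: "y \<in> Y" for y
  proof
    assume "meets s (f y) y"
    then obtain u where u: "s \<le> u" "card (f y \<inter> {s..<u}) + card (y \<inter> {s..<u}) > u - s"
      unfolding meets_def by blast
    show False
    \<comment> \<open>Up to \<open>t y\<close> the two heights cancel; afterwards both walks take
      the same steps and stay strictly lower than at \<open>t y\<close>.\<close>
    proof (cases "u \<le> t y")
      case True
      then show ?thesis using bef[OF u(1)] u by simp
    next
      case False
      then show ?thesis
        using u(2) bef[OF t(1)[OF y], of y] t(1)[OF y] t(3)[OF y, of u] aft[of y "t y" u]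
          card_Int_split[of s "t y" u y] card_Int_split[of s "t y" u "f y"] by simp
    qed
  qed
  have mem: "f y \<in> nsets {s..n} (b - r)" if y: "y \<in> Y" for y
  proof -
    have yy: "y \<subseteq> {s..n}" "card y = b" using y Y(1) by (auto simp: nsets_def)
    have le: "card (y \<inter> {s..<t y}) \<le> b" using yy fin[OF y] by (metis card_mono inf_le1)
    \<comment> \<open>Height \<open>r\<close> at \<open>t y\<close> takes
      \<open>(t y - s + r) / 2\<close> elements, at most \<open>b\<close>; so the reflected part
      stays inside \<open>{s..n}\<close>.\<close>
    then have tn: "t y \<le> Suc n" using t(1,2)[OF y] assms(3) by linarith
    then have sub: "f y \<subseteq> {s..n}" using yy t(1)[OF y] by (auto simp: f_def reflect_def)
    have "y \<inter> {s..<Suc n} = y" "f y \<inter> {s..<Suc n} = f y" using yy sub by force+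
    then have "card (f y) = card (f y \<inter> {s..<t y}) + card (y \<inter> {t y..<Suc n})"
      "b = card (y \<inter> {s..<t y}) + card (y \<inter> {t y..<Suc n})"
      using card_Int_split[OF t(1)[OF y] tn, of y] card_Int_split[OF t(1)[OF y] tn, of "f y"]
        aft[of y "t y" "Suc n"] yy by simp_all
    then have "card (f y) = b - r" using bef[OF t(1)[OF y], of y] t(1,2)[OF y] by simp
    moreover have "finite (f y)" using sub finite_subset by blast
    ultimately show ?thesis using sub by (simp add: nsets_def)
  qed
  \<comment> \<open>Otherwise \<open>f y\<close> would already be strictly below height
    \<open>-r\<close> at \<open>t z\<close>, where \<open>f z\<close> has height exactly
    \<open>-r\<close>.\<close>
  have tle: "t y \<ge> t z" if "y \<in> Y" "z \<in> Y" "f y = f z" for y z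
  proof (rule ccontr)
    assume "\<not> ?thesis"
    then have lt: "t y < t z" by simp
    have "card (f y \<inter> {s..<t z}) = card (f y \<inter> {s..<t y}) + card (y \<inter> {t y..<t z})"
      using card_Int_split[OF t(1)[OF that(1)], of "t z" "f y"] lt aft[of y "t y" "t z"] by simp
    then show False
      using t(3)[OF that(1) lt] bef[OF t(1)[OF that(1)], of y] bef[OF t(1)[OF that(2)], of z]
        t(2)[OF that(1)] t(2)[OF that(2)] t(1)[OF that(1)] lt that(3) by simp
  qed
  have "inj_on f Y"
  proof (rule inj_onI)
    fix y z assume yz: "y \<in> Y" "z \<in> Y" "f y = f z"
    have tt: "t y = t z" using tle[OF yz] tle[OF yz(2,1) yz(3)[symmetric]] by simp
    have rec: "w = ({s..<t w} - f w) \<union> (f w \<inter> {t w..})" if "w \<in> Y" for w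
    proof -
      have "w \<subseteq> {s..n}" using that Y(1) by (auto simp: nsets_def)
      then show ?thesis by (force simp: f_def reflect_def)
    qed
    show "y = z" using rec[OF yz(1)] rec[OF yz(2)] yz(3) tt by simp
  qed
  then show ?thesis using nm mem by blast
qed

lemma card_hits_le:
  assumes Y: "Y \<subseteq> nsets {s..n} b" "\<And>y. y \<in> Y \<Longrightarrow> hits s r y" and "2 * b + s \<le> n + 1 + r"
  shows "card Y \<le> (n + 1 - s) choose (b - r)"
proof -
  obtain f where f: "inj_on f Y" "f ` Y \<subseteq> nsets {s..n} (b - r)" using reflection[OF assms] by blast
  have "card Y \<le> card (nsets {s..n} (b - r))"
    by (rule card_inj_on_le[OF f]) (simp add: finite_imp_finite_nsets)
  then show ?thesis by (simp add: card_nsets)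
qed

text \<open>No \<open>y\<close> meets its own reflection, so the reflected copy of \<open>Y\<close>
  is disjoint from \<open>X\<close>, and both consist of \<open>a\<close>-subsets of
  \<open>{s..n}\<close>.\<close>

lemma card_cross_le:
  assumes X: "X \<subseteq> nsets {s..n} a" and Y: "Y \<subseteq> nsets {s..n} (a + r)" "\<And>y. y \<in> Y \<Longrightarrow> hits s r y"
    and XY: "\<And>x y. x \<in> X \<Longrightarrow> y \<in> Y \<Longrightarrow> meets s x y" and "2 * a + r + s \<le> n + 1"
  shows "card X + card Y \<le> (n + 1 - s) choose a"
proof -
  obtain f where f: "inj_on f Y" "f ` Y \<subseteq> nsets {s..n} a" "\<forall>y\<in>Y. \<not> meets s (f y) y"
    using reflection[OF Y] assms(5) by auto
  have "X \<inter> f ` Y = {}" using f(3) XY by blast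
  moreover have "finite (nsets {s..n} a)" by (simp add: finite_imp_finite_nsets)
  ultimately have "card X + card (f ` Y) \<le> card (nsets {s..n} a)"
    by (metis X f(2) card_Un_disjoint card_mono finite_subset le_sup_iff)
  then show ?thesis using f(1) by (simp add: card_nsets card_image)
qed

section \<open>Slices by the trace on an initial segment\<close>

text \<open>The trace itself is cut off, so that slices for different \<open>L\<close> live on the
  common ground set \<open>{s..n}\<close> and can be compared.\<close>

definition slice :: "nat \<Rightarrow> nat set \<Rightarrow> nat set set \<Rightarrow> nat set set" where
  "slice s L \<F> = (\<lambda>A. A \<inter> {s..}) ` {A \<in> \<F>. A \<inter> {..<s} = L}"

lemma card_slice: "card (slice s L \<F>) = card {A \<in> \<F>. A \<inter> {..<s} = L}"
proof -
  have "inj_on (\<lambda>A. A \<inter> {s..}) {A \<in> \<F>. A \<inter> {..<s} = L}"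
  proof (rule inj_onI)
    fix A B assume "A \<in> {A \<in> \<F>. A \<inter> {..<s} = L}" "B \<in> {A \<in> \<F>. A \<inter> {..<s} = L}"
      and "A \<inter> {s..} = B \<inter> {s..}"
    moreover have "C = (C \<inter> {..<s}) \<union> (C \<inter> {s..})" for C :: "nat set" by auto
    ultimately show "A = B" by (metis (mono_tags, lifting) mem_Collect_eq)
  qed
  then show ?thesis by (simp add: slice_def card_image)
qed

lemma slice_subset_nsets:
  assumes "\<F> \<subseteq> nsets {1..n} k"
  shows "slice s L \<F> \<subseteq> nsets {s..n} (k - card L)"
proof
  fix x assume "x \<in> slice s L \<F>"
  then obtain A where A: "A \<in> \<F>" "A \<inter> {..<s} = L" "x = A \<inter> {s..}" by (auto simp: slice_def)
  have AA: "A \<subseteq> {1..n}" "finite A" "card A = k" using A assms by (auto simp: nsets_def)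
  have "x = A - L" using A by auto
  moreover have "L \<subseteq> A" "finite L" using A AA by auto
  ultimately have "card x = k - card L" using AA by (simp add: card_Diff_subset)
  then show "x \<in> nsets {s..n} (k - card L)" using A AA by (auto simp: nsets_def)
qed

lemma card_slice_split:
  assumes "finite \<F>" "L \<subseteq> {..<s}" "t = Suc s"
  shows "card (slice s L \<F>) = card (slice t L \<F>) + card (slice t (insert s L) \<F>)"
proof -
  have e: "{A \<in> \<F>. A \<inter> {..<s} = L} =
      {A \<in> \<F>. A \<inter> {..<t} = L} \<union> {A \<in> \<F>. A \<inter> {..<t} = insert s L}" (is "_ = ?P \<union> ?Q")
  proof -
    have "A \<inter> {..<s} = L \<longleftrightarrow> A \<inter> {..<t} = L \<or> A \<inter> {..<t} = insert s L" for A
    proof (cases "s \<in> A")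
      case True
      then have "A \<inter> {..<t} = insert s (A \<inter> {..<s})" using assms(3) by (auto simp: less_Suc_eq)
      moreover have "s \<notin> A \<inter> {..<s}" "s \<notin> L" using assms(2) by auto
      ultimately show ?thesis by (metis insertI1 insert_ident)
    next
      case False
      then have "A \<inter> {..<t} = A \<inter> {..<s}" using assms(3) by (auto simp: less_Suc_eq)
      then show ?thesis using False by auto
    qed
    then show ?thesis by auto
  qed
  have "?P \<inter> ?Q = {}" using assms(2) by auto
  then show ?thesis using assms(1) unfolding card_slice e by (simp add: card_Un_disjoint)
qed

text \<open>Disjoint traces contribute nothing to an intersection; if the walks did not meet either,
  shifting within \<open>{s..}\<close> would produce two disjoint members.\<close>

lemma slice_meets:
  assumes "\<F> \<subseteq> nsets {1..n} k" "stable s \<F>" "intersecting \<F>" "L \<inter> M = {}"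
    and "x \<in> slice s L \<F>" "y \<in> slice s M \<F>"
  shows "meets s x y"
proof (rule ccontr)
  assume nm: "\<not> meets s x y"
  obtain A where A: "A \<in> \<F>" "A \<inter> {..<s} = L" "x = A \<inter> {s..}" using assms(5) by (auto simp: slice_def)
  obtain B where B: "B \<in> \<F>" "B \<inter> {..<s} = M" "y = B \<inter> {s..}" using assms(6) by (auto simp: slice_def)
  have "x \<inter> {s..<u} = A \<inter> {s..<u}" "y \<inter> {s..<u} = B \<inter> {s..<u}" for u using A B by auto
  then have "\<not> meets s A B" using nm by (simp add: meets_def)
  moreover have "finite (A \<inter> B)" using A assms(1) by (auto simp: nsets_def)
  moreover have "A \<inter> B \<inter> {..<s} = {}" using A B assms(4) by auto
  ultimately have "\<exists>A'\<in>\<F>. A' \<inter> B = {}" using stable_imp_disjoint[OF assms(2) A(1)] by blast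
  then show False using assms(3) B by (auto simp: intersecting_def)
qed

text \<open>The members of the \<open>M\<close>-slice are larger by exactly \<open>r\<close>, and
  reflecting at height \<open>r\<close> removes just that difference.\<close>

lemma slice_pair_le:
  assumes "\<F> \<subseteq> nsets {1..n} k" "stable s \<F>" "intersecting \<F>" "L \<inter> M = {}"
    and "card L = c" "c = card M + r" "c \<le> k" "2 * k + s \<le> n + 1"
    and "\<And>y. y \<in> slice s M \<F> \<Longrightarrow> hits s r y"
  shows "card (slice s L \<F>) + card (slice s M \<F>) \<le> (n + 1 - s) choose (k - c)"
proof (rule card_cross_le)
  show "slice s L \<F> \<subseteq> nsets {s..n} (k - c)"
    using slice_subset_nsets[OF assms(1)] assms(5) by metis
  have "k - card M = k - c + r" using assms(6,7) by simp
  then show "slice s M \<F> \<subseteq> nsets {s..n} (k - c + r)" using slice_subset_nsets[OF assms(1)] by metis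
  show "meets s x y" if "x \<in> slice s L \<F>" "y \<in> slice s M \<F>" for x y
    by (rule slice_meets[OF assms(1-4) that])
  show "2 * (k - c) + r + s \<le> n + 1" using assms(6-8) by linarith
qed (rule assms(9))

lemma slice_hits_le:
  assumes "\<F> \<subseteq> nsets {1..n} k" "2 * k + s \<le> n + 1" "\<And>y. y \<in> slice s L \<F> \<Longrightarrow> hits s r y"
  shows "card (slice s L \<F>) \<le> (n + 1 - s) choose (k - card L - r)"
  by (rule card_hits_le[OF slice_subset_nsets[OF assms(1)] assms(3)]) (use assms(2) in auto)

lemma stable_mono: "stable s \<F> \<Longrightarrow> s \<le> t \<Longrightarrow> stable t \<F>"
  unfolding stable_def by (meson le_trans)

lemma hits_Int: "hits s r (A \<inter> {s..}) \<longleftrightarrow> hits s r A"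
proof -
  have "A \<inter> {s..} \<inter> {s..<u} = A \<inter> {s..<u}" for u by auto
  then show ?thesis by (simp add: hits_def)
qed

text \<open>The sum of the two heights at a point is even, so once positive it is at least 2. Of
  this \<open>x\<close> contributes at most \<open>r - 1\<close>, which leaves \<open>3 - r\<close>
  for \<open>y\<close>.\<close>

lemma meets_imp_hits:
  assumes "meets s x y" "\<not> hits s r x" "r + q \<le> 3"
  shows "hits s q y"
proof -
  obtain u where u: "s \<le> u" "card (x \<inter> {s..<u}) + card (y \<inter> {s..<u}) > u - s"
    using assms(1) by (auto simp: meets_def)
  have "2 * card (x \<inter> {s..<u}) < u - s + r" using assms(2) u(1) unfolding hits_def by force
  then have "u - s + q \<le> 2 * card (y \<inter> {s..<u})" using u assms(3) by linarith
  then show ?thesis using u(1) by (auto simp: hits_def)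
qed

text \<open>With \<open>c\<close> elements in \<open>{s..<t}\<close> the height at \<open>t\<close>
  is \<open>2 * c - (t - s)\<close>; what is missing to \<open>r\<close> has to be gained later. The
  bound \<open>2 * c \<le> r\<close> excludes that \<open>r\<close> is reached before
  \<open>t\<close>.\<close>

lemma hits_later:
  assumes "hits s r A" "0 < r" "s \<le> t" "2 * card (A \<inter> {s..<t}) \<le> r"
    and "q + 2 * card (A \<inter> {s..<t}) \<le> r + (t - s)"
  shows "hits t q (A \<inter> {t..})"
proof -
  obtain u where u: "s \<le> u" "u - s + r \<le> 2 * card (A \<inter> {s..<u})"
    using assms(1) by (auto simp: hits_def)
  have "t \<le> u"
  proof (rule ccontr)
    assume "\<not> t \<le> u"
    then have "card (A \<inter> {s..<u}) \<le> card (A \<inter> {s..<t})" by (intro card_mono) auto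
    then have "u = s" using u assms(4) by linarith
    then show False using u assms(2) by simp
  qed
  then have "u - t + q \<le> 2 * card (A \<inter> {t..<u})"
    using card_Int_split[OF assms(3), of u A] u assms(3,5) by linarith
  then show ?thesis using \<open>t \<le> u\<close> unfolding hits_Int by (auto simp: hits_def)
qed

section \<open>Binomial estimates and counting by slices\<close>

text \<open>Absorption gives \<open>(k - 2) * m = (n - k) * e\<close>, and \<open>36 * k < n\<close>
  makes the factor \<open>n - k\<close> at least \<open>35 * (k - 2)\<close>. The rest is Pascal's
  rule and monotonicity below the middle.\<close>

lemma binomial_estimates:
  fixes n k :: nat
  assumes "3 \<le> k" "36 * k < n"
  defines "e \<equiv> (n - 3) choose (k - 3)" and "m \<equiv> (n - 3) choose (k - 2)"
  shows "0 < e" "e * (n - k) \<le> k * m" "35 * e \<le> m" "(n - 2) choose (k - 2) = m + e"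
    "(n - 2) choose (k - 3) \<le> 2 * e" "(n - 1) choose (k - 2) \<le> m + 3 * e"
proof -
  define K N where "K = k - 3" and "N = n - 3"
  have K: "k = K + 3" and N: "n = N + 3" using assms(1,2) by (simp_all add: K_def N_def)
  have c1: "n - 2 = Suc N" "n - 1 = Suc (Suc N)" "k - 2 = Suc K" using K N by simp_all
  have e: "e = N choose K" and m: "m = N choose Suc K"
    by (simp_all add: e_def m_def c1 K_def N_def)
  have NK: "36 * K + 105 < N" using assms(2) K N by simp
  show "0 < e" using NK by (simp add: e)
  have abs: "Suc K * m = (N - K) * e"
    unfolding e m binomial_absorption binomial_absorb_comp ..
  have nk: "n - k = N - K" using K N by simp
  have "e * (n - k) = Suc K * m" unfolding nk abs by (rule mult.commute)
  also have "\<dots> \<le> k * m" unfolding K by (rule mult_le_mono1) simp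
  finally show "e * (n - k) \<le> k * m" .
  have "35 * Suc K + K \<le> N" using NK by simp
  then have "35 * Suc K \<le> N - K" by (rule add_le_imp_le_diff)
  from mult_le_mono1[OF this, of e] have "Suc K * (35 * e) \<le> (N - K) * e" by (simp only: mult_ac)
  then show "35 * e \<le> m" using abs by (metis Suc_mult_le_cancel1)
  show "(n - 2) choose (k - 2) = m + e" unfolding c1 e m by simp
  have b: "Suc N choose K \<le> 2 * e"
  proof (cases K)
    case 0
    then show ?thesis by (simp add: e)
  next
    case (Suc K')
    have "N choose K' \<le> N choose K" using NK Suc by (intro binomial_mono) auto
    then show ?thesis using Suc by (simp add: e)
  qed
  then show "(n - 2) choose (k - 3) \<le> 2 * e" unfolding c1 K_def .
  show "(n - 1) choose (k - 2) \<le> m + 3 * e" using b unfolding c1 by (simp add: e m)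
qed

lemma card_eq_slices:
  assumes "\<F> \<subseteq> nsets {1..n} k"
  shows "card \<F> = card (slice 2 {} \<F>) + card (slice 2 {1} \<F>)"
    "card (slice 2 {} \<F>) = card (slice 3 {} \<F>) + card (slice 3 {2} \<F>)"
    "card (slice 2 {1} \<F>) = card (slice 3 {1} \<F>) + card (slice 3 {2, 1} \<F>)"
    "L \<subseteq> {1, 2} \<Longrightarrow> card (slice 3 L \<F>) = card (slice 4 L \<F>) + card (slice 4 (insert 3 L) \<F>)"
proof -
  note fin = finite_family[OF assms]
  have "A \<inter> {..<1} = {}" if "A \<in> \<F>" for A using subset_nsetsD[OF assms that] by auto
  then have "{A \<in> \<F>. A \<inter> {..<1} = {}} = \<F>" by blast
  then have "card \<F> = card (slice 1 {} \<F>)" by (simp add: card_slice)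
  then show "card \<F> = card (slice 2 {} \<F>) + card (slice 2 {1} \<F>)"
    using card_slice_split[OF fin, of "{}" 1 2] by simp
  show "card (slice 2 {} \<F>) = card (slice 3 {} \<F>) + card (slice 3 {2} \<F>)"
    using card_slice_split[OF fin, of "{}" 2 3] by simp
  show "card (slice 2 {1} \<F>) = card (slice 3 {1} \<F>) + card (slice 3 {2, 1} \<F>)"
    using card_slice_split[OF fin, of "{1}" 2 3] by simp
  show "card (slice 3 L \<F>) = card (slice 4 L \<F>) + card (slice 4 (insert 3 L) \<F>)" if "L \<subseteq> {1, 2}"
    using card_slice_split[OF fin, of L 3 4] that by fastforce
qed

lemma lessThan_Int_iff:
  fixes A :: "nat set"
  assumes "\<F> \<subseteq> nsets {1..n} k" "A \<in> \<F>"
  shows "A \<inter> {..<2} = {} \<longleftrightarrow> 1 \<notin> A" "A \<inter> {..<3} = {} \<longleftrightarrow> 1 \<notin> A \<and> 2 \<notin> A"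
proof -
  have "0 \<notin> A" using subset_nsetsD[OF assms] by auto
  moreover have "{..<2} = {0, 1::nat}" "{..<3} = {0, 1, 2::nat}" by auto
  ultimately show "A \<inter> {..<2} = {} \<longleftrightarrow> 1 \<notin> A" "A \<inter> {..<3} = {} \<longleftrightarrow> 1 \<notin> A \<and> 2 \<notin> A"
    by auto
qed

lemma card_avoiding:
  assumes "\<F> \<subseteq> nsets {1..n} k"
  shows "card {A \<in> \<F>. 1 \<notin> A} = card (slice 2 {} \<F>)"
    "card {A \<in> \<F>. 1 \<notin> A \<and> 2 \<notin> A} = card (slice 3 {} \<F>)"
    "card {A \<in> \<F>. 2 \<notin> A} = card (slice 3 {} \<F>) + card (slice 3 {1} \<F>)"
proof -
  show "card {A \<in> \<F>. 1 \<notin> A} = card (slice 2 {} \<F>)"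
    unfolding card_slice by (rule arg_cong[of _ _ card]) (use lessThan_Int_iff(1)[OF assms] in blast)
  show "card {A \<in> \<F>. 1 \<notin> A \<and> 2 \<notin> A} = card (slice 3 {} \<F>)"
    unfolding card_slice by (rule arg_cong[of _ _ card]) (use lessThan_Int_iff(2)[OF assms] in blast)
  have "A \<inter> {..<3} = {} \<or> A \<inter> {..<3} = {1} \<longleftrightarrow> 2 \<notin> A" if "A \<in> \<F>" for A
  proof -
    have "0 \<notin> A" using subset_nsetsD[OF assms that] by auto
    then have "A \<inter> {..<3} = A \<inter> {1, 2}" by (auto simp: less_Suc_eq numeral_3_eq_3 simp del: One_nat_def)
    then show ?thesis by (cases "1 \<in> A"; cases "2 \<in> A") simp_all
  qed
  then have "{A \<in> \<F>. 2 \<notin> A} = {A \<in> \<F>. A \<inter> {..<3} = {}} \<union> {A \<in> \<F>. A \<inter> {..<3} = {1}}" by blast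
  moreover have "{A \<in> \<F>. A \<inter> {..<3} = {}} \<inter> {A \<in> \<F>. A \<inter> {..<3} = {1}} = {}" by auto
  ultimately show "card {A \<in> \<F>. 2 \<notin> A} = card (slice 3 {} \<F>) + card (slice 3 {1} \<F>)"
    using finite_family[OF assms] by (simp add: card_slice card_Un_disjoint)
qed

text \<open>A \<open>k\<close>-set belongs to \<open>F3\<close> as soon as its trace on
  \<open>{1, 2, 3}\<close> has two elements, so four slices are full.\<close>

lemma card_F3_ge:
  fixes n k :: nat
  assumes "3 \<le> k" "k \<le> n"
  shows "3 * ((n - 3) choose (k - 2)) + ((n - 3) choose (k - 3)) \<le> card (F3 n k)"
proof -
  have sub: "F3 n k \<subseteq> nsets {1..n} k" by (auto simp: F3_def)
  have le: "(n - 3) choose (k - c) \<le> card (slice 4 L (F3 n k))"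
    if L: "L \<in> {{3, 2, 1}, {2, 1}, {3, 1}, {3, 2}}" and c: "card L = c" for L c
  proof -
    have L3: "L \<subseteq> {1, 2, 3}" "card L \<le> 3" "finite L" using L by auto
    have "nsets {4..n} (k - card L) \<subseteq> slice 4 L (F3 n k)"
    proof
      fix x assume "x \<in> nsets {4..n} (k - card L)"
      then have x: "x \<subseteq> {4..n}" "finite x" "card x = k - card L" by (auto simp: nsets_def)
      have d: "L \<inter> x = {}" using x(1) L3(1) by fastforce
      have "card (L \<union> x) = k" using card_Un_disjoint[OF L3(3) x(2) d] x(3) L3(2) assms by simp
      then have "L \<union> x \<in> nsets {1..n} k" using x L3 assms by (force simp: nsets_def)
      then have "L \<union> x \<in> F3 n k" using L by (auto simp: F3_def)
      moreover have "(L \<union> x) \<inter> {..<4} = L" "(L \<union> x) \<inter> {4..} = x" using x(1) L3(1) by fastforce+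
      ultimately show "x \<in> slice 4 L (F3 n k)" unfolding slice_def by blast
    qed
    then have "card (nsets {4..n} (k - card L)) \<le> card (slice 4 L (F3 n k))"
      by (rule card_mono[rotated]) (simp add: slice_def finite_family[OF sub])
    then show ?thesis by (simp add: card_nsets c)
  qed
  have L: "L \<subseteq> {1, 2}" if "L \<in> {{}, {1}, {2}, {2, 1::nat}}" for L using that by auto
  show ?thesis
    using le[of "{3, 2, 1}" 3] le[of "{2, 1}" 2] le[of "{3, 1}" 2] le[of "{3, 2}" 2] card_eq_slices[OF sub]
      L[of "{1}"] L[of "{2}"] L[of "{2, 1}"] by simp
qed

section \<open>Members missing the point 1\<close>

text \<open>Three of the four complementary pairs of traces always obey the reflection bound. As
  \<open>\<F>\<close> exceeds \<open>3 * m + e\<close>, the pair \<open>{1}\<close>,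
  \<open>{2, 3}\<close> must violate it, and the walk responsible forces all four slices without
  \<open>1\<close> to be small.\<close>

lemma card_avoiding_1_le:
  assumes k: "3 \<le> k" "36 * k < n" and F: "\<F> \<subseteq> nsets {1..n} k" "intersecting \<F>"
    and st: "stable 2 \<F>" and big: "card (F3 n k) < card \<F>"
    and hit: "\<And>A. A \<in> \<F> \<Longrightarrow> 1 \<notin> A \<Longrightarrow> hits 2 2 A"
  shows "card (slice 2 {} \<F>) \<le> 4 * ((n - 3) choose (k - 3))"
proof -
  define e where "e = (n - 3) choose (k - 3)"
  define m where "m = (n - 3) choose (k - 2)"
  have kn: "k \<le> n" using k(2) by simp
  have st4: "stable 4 \<F>" using stable_mono[OF st] by simp
  \<comment> \<open>With trace \<open>L\<close> the walk from \<open>2\<close> has height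
    \<open>2 * card L - 2\<close> at \<open>4\<close>, so it still has to climb
    \<open>4 - 2 * card L\<close> to reach height 2.\<close>
  have hit4: "hits 4 q y"
    if y: "y \<in> slice 4 L \<F>" and L: "L \<in> {{}, {2}, {3}}" and q: "q + 2 * card L \<le> 4" for y L q
  proof -
    obtain A where A: "A \<in> \<F>" "A \<inter> {..<4} = L" "y = A \<inter> {4..}" using y by (auto simp: slice_def)
    have L2: "1 \<notin> L" "L \<inter> {2..} = L" "2 * card L \<le> 2" using L by auto
    have "1 \<notin> A"
    proof
      assume "1 \<in> A"
      then have "1 \<in> A \<inter> {..<4}" by simp
      then show False using A(2) L2(1) by simp
    qed
    have "A \<inter> {2..<4} = (A \<inter> {..<4}) \<inter> {2..}" by auto
    then have "A \<inter> {2..<4} = L" using A(2) L2(2) by simp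
    then show ?thesis using hits_later[OF hit[OF A(1) \<open>1 \<notin> A\<close>], of 4 q] A(3) q L2(3) by simp
  qed
  have pair: "card (slice 4 L \<F>) + card (slice 4 M \<F>) \<le> (n - 3) choose (k - c)"
    if "card L = c" "L \<inter> M = {}" "c = card M + r" "c \<le> 3" "\<And>y. y \<in> slice 4 M \<F> \<Longrightarrow> hits 4 r y"
    for L M r c
    using slice_pair_le[OF F(1) st4 F(2) that(2,1,3)] that k by simp
  have p0: "card (slice 4 {3, 2, 1} \<F>) + card (slice 4 {} \<F>) \<le> e"
    using pair[of "{3, 2, 1}" 3 "{}" 3] hit4[of _ "{}" 3] by (simp add: e_def)
  have p3: "card (slice 4 {2, 1} \<F>) + card (slice 4 {3} \<F>) \<le> m"
    using pair[of "{2, 1}" 2 "{3}" 1] hit4[of _ "{3}" 1] by (simp add: m_def)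
  have p2: "card (slice 4 {3, 1} \<F>) + card (slice 4 {2} \<F>) \<le> m"
    using pair[of "{3, 1}" 2 "{2}" 1] hit4[of _ "{2}" 1] by (simp add: m_def)
  have L: "L \<subseteq> {1, 2}" if "L \<in> {{}, {1}, {2}, {2, 1::nat}}" for L using that by auto
  note sl = card_eq_slices[OF F(1)]
  have "\<not> (\<forall>y\<in>slice 4 {1} \<F>. hits 4 1 y)"
  proof
    assume "\<forall>y\<in>slice 4 {1} \<F>. hits 4 1 y"
    then have "card (slice 4 {3, 2} \<F>) + card (slice 4 {1} \<F>) \<le> m"
      using pair[of "{3, 2}" 2 "{1}" 1] by (simp add: m_def)
    then have "card \<F> \<le> 3 * m + e"
      using p0 p2 p3 sl L[of "{1}"] L[of "{2}"] L[of "{2, 1}"] by simp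
    then show False using big card_F3_ge[OF k(1) kn] by (simp add: e_def m_def)
  qed
  then obtain x where x: "x \<in> slice 4 {1} \<F>" "\<not> hits 4 1 x" by blast
  have "hits 4 1 y" if "y \<in> slice 4 {3, 2} \<F>" for y
    using meets_imp_hits[OF slice_meets[OF F(1) st4 F(2) _ x(1) that] x(2), of 1] by simp
  \<comment> \<open>Here and in the next three bounds the trace size and the height add up to 3, so
    each slice is compared with \<open>(k - 3)\<close>-sets.\<close>
  then have q23: "card (slice 4 {3, 2} \<F>) \<le> e"
    using slice_hits_le[OF F(1), of 4 "{3, 2}" 1] k by (simp add: e_def numeral_3_eq_3)
  have q2: "card (slice 4 {2} \<F>) \<le> e"
    using slice_hits_le[OF F(1), of 4 "{2}" 2] hit4[of _ "{2}" 2] k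
    by (simp add: e_def numeral_3_eq_3)
  have q3: "card (slice 4 {3} \<F>) \<le> e"
    using slice_hits_le[OF F(1), of 4 "{3}" 2] hit4[of _ "{3}" 2] k
    by (simp add: e_def numeral_3_eq_3)
  have q0: "card (slice 4 {} \<F>) \<le> e"
    using slice_hits_le[OF F(1), of 4 "{}" 3] hit4[of _ "{}" 3] k by (simp add: e_def)
  show ?thesis
    using q0 q2 q3 q23 sl L[of "{2}"] by (simp add: e_def)
qed

text \<open>Shifting on \<open>{2..n}\<close> keeps the counts with and without \<open>1\<close>.
  Either all walks without \<open>1\<close> reach height 2, or a low one forces those with
  \<open>1\<close> to reach height 1. Then at most \<open>m + 3 * e\<close> members contain
  \<open>1\<close>, and more than \<open>2 * m - 2 * e\<close> miss it.\<close>

lemma card_avoiding_1_gap: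
  assumes k: "3 \<le> k" "36 * k < n" and F: "\<F> \<subseteq> nsets {1..n} k" "intersecting \<F>"
    and big: "card (F3 n k) < card \<F>"
  shows "card {A \<in> \<F>. 1 \<notin> A} \<le> 4 * ((n - 3) choose (k - 3)) \<or>
    (n - 3) choose (k - 2) < card {A \<in> \<F>. 1 \<notin> A}"
proof -
  have kn: "k \<le> n" using k(2) by simp
  note est = binomial_estimates[OF k]
  obtain \<G> where G: "\<G> \<subseteq> nsets {1..n} k" "intersecting \<G>" "stable 2 \<G>"
    and card_G: "\<And>L. card {A \<in> \<G>. A \<inter> {..<2} = L} = card {A \<in> \<F>. A \<inter> {..<2} = L}"
    using ex_stable[OF F, of 2] by auto
  have sl: "card (slice 2 L \<G>) = card (slice 2 L \<F>)" for L using card_G by (simp add: card_slice)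
  have cG: "card \<G> = card \<F>" using card_eq_slices(1)[OF F(1)] card_eq_slices(1)[OF G(1)] sl by simp
  show ?thesis
  proof (cases "\<forall>A\<in>\<G>. 1 \<notin> A \<longrightarrow> hits 2 2 A")
    case True
    then show ?thesis
      using card_avoiding_1_le[OF k G] big cG sl card_avoiding(1)[OF F(1)] by simp
  next
    case False
    then obtain B where B: "B \<in> \<G>" "1 \<notin> B" "\<not> hits 2 2 B" by blast
    have xB: "B \<inter> {2..} \<in> slice 2 {} \<G>"
      using B lessThan_Int_iff(1)[OF G(1) B(1)] unfolding slice_def by blast
    have "hits 2 1 y" if "y \<in> slice 2 {1} \<G>" for y
      using meets_imp_hits[OF slice_meets[OF G(1,3,2) _ xB that], of 2 1] B(3) by (simp add: hits_Int)
    then have "card (slice 2 {1} \<G>) \<le> (n - 1) choose (k - 2)"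
      using slice_hits_le[OF G(1), of 2 "{1}" 1] k by (simp add: numeral_2_eq_2)
    then show ?thesis
      using est(1,3,6) big cG sl card_avoiding(1)[OF F(1)] card_F3_ge[OF k(1) kn]
        card_eq_slices(1)[OF F(1)] by simp
  qed
qed

section \<open>Arbitrary points and pairs of points\<close>

lemma relabel:
  fixes \<pi> :: "nat \<Rightarrow> nat"
  assumes "inj \<pi>" "\<pi> ` {1..n} \<subseteq> {1..n}" and F: "\<F> \<subseteq> nsets {1..n} k" "intersecting \<F>"
  defines "\<G> \<equiv> (`) \<pi> ` \<F>"
  shows "\<G> \<subseteq> nsets {1..n} k" "intersecting \<G>" "card \<G> = card \<F>"
    "card {A \<in> \<G>. \<pi> x \<notin> A} = card {A \<in> \<F>. x \<notin> A}"
    "card {A \<in> \<G>. \<pi> x \<notin> A \<and> \<pi> y \<notin> A} = card {A \<in> \<F>. x \<notin> A \<and> y \<notin> A}"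
proof -
  have inj: "inj ((`) \<pi>)" using assms(1) by (simp add: inj_image_eq_iff inj_def)
  have "\<pi> ` A \<in> nsets {1..n} k" if "A \<in> \<F>" for A
  proof -
    have "A \<subseteq> {1..n}" "finite A" "card A = k" using that F(1) by (auto simp: nsets_def)
    moreover have "card (\<pi> ` A) = card A" by (rule card_image[OF inj_on_subset[OF assms(1) subset_UNIV]])
    ultimately show ?thesis using assms(2) by (auto simp: nsets_def)
  qed
  then show "\<G> \<subseteq> nsets {1..n} k" by (auto simp: \<G>_def)
  show "intersecting \<G>" using F(2) by (fastforce simp: \<G>_def intersecting_def)
  show "card \<G> = card \<F>" unfolding \<G>_def by (rule card_image[OF inj_on_subset[OF inj subset_UNIV]])
  have c: "card {A \<in> \<G>. P A} = card {A \<in> \<F>. P (\<pi> ` A)}" for P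
  proof -
    have "{A \<in> \<G>. P A} = (`) \<pi> ` {A \<in> \<F>. P (\<pi> ` A)}" by (auto simp: \<G>_def)
    then show ?thesis by (simp add: card_image[OF inj_on_subset[OF inj subset_UNIV]])
  qed
  show "card {A \<in> \<G>. \<pi> x \<notin> A} = card {A \<in> \<F>. x \<notin> A}"
    "card {A \<in> \<G>. \<pi> x \<notin> A \<and> \<pi> y \<notin> A} = card {A \<in> \<F>. x \<notin> A \<and> y \<notin> A}"
    unfolding c by (simp_all add: inj_image_mem_iff[OF assms(1)])
qed

lemma transpose_image_atLeastAtMost:
  assumes "a \<in> {1..n}" "b \<in> {1..n}"
  shows "transpose a b ` {1..n::nat} \<subseteq> {1..n}"
  using assms by (auto simp: transpose_def)

lemma card_avoiding_gap:
  assumes k: "3 \<le> k" "36 * k < n" and F: "\<F> \<subseteq> nsets {1..n} k" "intersecting \<F>"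
    and big: "card (F3 n k) < card \<F>" and x: "x \<in> {1..n}"
  shows "card {A \<in> \<F>. x \<notin> A} \<le> 4 * ((n - 3) choose (k - 3)) \<or>
    (n - 3) choose (k - 2) < card {A \<in> \<F>. x \<notin> A}"
proof -
  have "transpose x 1 ` {1..n} \<subseteq> {1..n}" using x by (intro transpose_image_atLeastAtMost) auto
  note r = relabel[OF inj_transpose this F]
  show ?thesis using card_avoiding_1_gap[OF k r(1,2)] r(3) r(4)[of x] big by simp
qed

text \<open>If few members missed both points, then each of the traces \<open>{1}\<close> and
  \<open>{2}\<close> on \<open>{1, 2}\<close> would occur more than \<open>m - 4 * e\<close> times.
  This excludes low walks, so that the pairs \<open>{1, 3}\<close>, \<open>{2}\<close> and
  \<open>{2, 3}\<close>, \<open>{1}\<close> give \<open>m\<close> each and \<open>{1, 2}\<close>,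
  \<open>{}\<close> gives \<open>m + e\<close>, in total \<open>3 * m + e\<close>.\<close>

lemma no_large_pair_1_2:
  assumes k: "3 \<le> k" "36 * k < n" and F: "\<F> \<subseteq> nsets {1..n} k" "intersecting \<F>"
    and big: "card (F3 n k) < card \<F>"
    and "(n - 3) choose (k - 2) < card {A \<in> \<F>. 1 \<notin> A}"
    and "(n - 3) choose (k - 2) < card {A \<in> \<F>. 2 \<notin> A}"
  shows "4 * ((n - 3) choose (k - 3)) < card {A \<in> \<F>. 1 \<notin> A \<and> 2 \<notin> A}"
proof (rule ccontr)
  assume small: "\<not> ?thesis"
  define e where "e = (n - 3) choose (k - 3)"
  define m where "m = (n - 3) choose (k - 2)"
  note est = binomial_estimates[OF k, folded e_def m_def]
  obtain \<G> where G: "\<G> \<subseteq> nsets {1..n} k" "intersecting \<G>" "stable 3 \<G>"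
    and card_G: "\<And>L. card {A \<in> \<G>. A \<inter> {..<3} = L} = card {A \<in> \<F>. A \<inter> {..<3} = L}"
    using ex_stable[OF F, of 3] by auto
  have kn: "k \<le> n" using k(2) by simp
  have st4: "stable 4 \<G>" using stable_mono[OF G(3)] by simp
  have sl: "card (slice 3 L \<G>) = card (slice 3 L \<F>)" for L using card_G by (simp add: card_slice)
  note slF = card_eq_slices[OF F(1)] and slG = card_eq_slices[OF G(1)] and av = card_avoiding[OF F(1)]
  have R: "card (slice 3 {} \<G>) \<le> 4 * e" using small av(2) sl by (simp add: e_def)
  have Q: "m < card (slice 3 {} \<G>) + card (slice 3 {a} \<G>)" if "a \<in> {1, 2}" for a
    using assms(6,7) av(1,3) slF(2) sl that by (auto simp: m_def)
  have hit: "hits 4 1 y" if y: "y \<in> slice 4 {a} \<G>" and ab: "(a, b) \<in> {(1, 2), (2, 1)}"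
    for y and a b :: nat
  proof (rule ccontr)
    assume nh: "\<not> hits 4 1 y"
    obtain A where A: "A \<in> \<G>" "A \<inter> {..<4} = {a}" "y = A \<inter> {4..}" using y by (auto simp: slice_def)
    have "A \<inter> {..<3} = (A \<inter> {..<4}) \<inter> {..<3}" "A \<inter> {3..<4} = (A \<inter> {..<4}) \<inter> {3}" by auto
    moreover have "{a} \<inter> {..<3} = {a}" "{a} \<inter> {3} = {}" using ab by auto
    ultimately have A3: "A \<inter> {..<3} = {a}" "A \<inter> {3..<4} = {}" using A(2) by simp_all
    \<comment> \<open>As \<open>3\<close> is not in \<open>A\<close>, the walk starts with a step
      down, and reaching height 1 from \<open>3\<close> would imply reaching it from
      \<open>4\<close>.\<close>
    have "\<not> hits 3 1 A" using nh hits_later[of 3 1 A 4 1] A3(2) A(3) by auto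
    moreover have "A \<inter> {3..} \<in> slice 3 {a} \<G>" using A(1) A3(1) unfolding slice_def by blast
    ultimately have "hits 3 2 q" if "q \<in> slice 3 {b} \<G>" for q
      using meets_imp_hits[OF slice_meets[OF G(1,3,2) _ _ that], of "{a}" "A \<inter> {3..}" 1 2] ab
      by (auto simp: hits_Int)
    then have "card (slice 3 {b} \<G>) \<le> (n - 2) choose (k - 3)"
      using slice_hits_le[OF G(1), of 3 "{b}" 2] k by (simp add: numeral_eq_Suc)
    then show False using Q[of b] R est(1,3,5) ab by auto
  qed
  have p13: "card (slice 4 {3, 1} \<G>) + card (slice 4 {2} \<G>) \<le> m"
    using slice_pair_le[OF G(1) st4 G(2), of "{3, 1}" "{2}" 2 1] hit[of _ 2 1] k
    by (simp add: m_def)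
  have p23: "card (slice 4 {3, 2} \<G>) + card (slice 4 {1} \<G>) \<le> m"
    using slice_pair_le[OF G(1) st4 G(2), of "{3, 2}" "{1}" 2 1] hit[of _ 1 2] k
    by (simp add: m_def)
  have "card (slice 3 {2, 1} \<G>) + card (slice 3 {} \<G>) \<le> m + e"
  proof (cases "\<forall>y\<in>slice 3 {} \<G>. hits 3 2 y")
    case True
    then show ?thesis
      using slice_pair_le[OF G(1,3,2), of "{2, 1}" "{}" 2 2] k est(4) by (simp add: numeral_eq_Suc)
  next
    case False
    then obtain x where x: "x \<in> slice 3 {} \<G>" "\<not> hits 3 2 x" by blast
    have "hits 3 1 y" if "y \<in> slice 3 {2, 1} \<G>" for y
      using meets_imp_hits[OF slice_meets[OF G(1,3,2) _ x(1) that] x(2), of 1] by simp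
    then have "card (slice 3 {2, 1} \<G>) \<le> (n - 2) choose (k - 3)"
      using slice_hits_le[OF G(1), of 3 "{2, 1}" 1] k by (simp add: numeral_eq_Suc)
    then show ?thesis using R est(1,3,5) by simp
  qed
  moreover have "card \<F> = card (slice 3 {2, 1} \<G>) + card (slice 3 {} \<G>)
      + card (slice 3 {1} \<G>) + card (slice 3 {2} \<G>)"
    using slF(1-3) sl by simp
  ultimately have "card \<F> \<le> 3 * m + e" using p13 p23 slG(4)[of "{1}"] slG(4)[of "{2}"] by simp
  then show False using big card_F3_ge[OF k(1) kn] by (simp add: e_def m_def)
qed

lemma no_large_pair:
  assumes k: "3 \<le> k" "36 * k < n" and F: "\<F> \<subseteq> nsets {1..n} k" "intersecting \<F>"
    and big: "card (F3 n k) < card \<F>" and ij: "i \<in> {1..n}" "j \<in> {1..n}" "i \<noteq> j"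
    and "(n - 3) choose (k - 2) < card {A \<in> \<F>. i \<notin> A}"
    and "(n - 3) choose (k - 2) < card {A \<in> \<F>. j \<notin> A}"
  shows "4 * ((n - 3) choose (k - 3)) < card {A \<in> \<F>. i \<notin> A \<and> j \<notin> A}"
proof -
  \<comment> \<open>First \<open>i\<close> goes to \<open>1\<close>, then the image of
    \<open>j\<close> to \<open>2\<close>; that image is not \<open>1\<close>, so \<open>1\<close>
    stays fixed in the second step.\<close>
  define \<pi> where "\<pi> = transpose (transpose i 1 j) 2 \<circ> transpose i 1"
  have n: "2 \<le> n" using k by simp
  have t: "transpose i 1 ` {1..n} \<subseteq> {1..n}" using ij n by (intro transpose_image_atLeastAtMost) auto
  then have "transpose i 1 j \<in> {1..n}" using ij(2) by (meson image_subset_iff)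
  then have "transpose (transpose i 1 j) 2 ` {1..n} \<subseteq> {1..n}"
    using n by (intro transpose_image_atLeastAtMost) auto
  then have sub: "\<pi> ` {1..n} \<subseteq> {1..n}" using t unfolding \<pi>_def by (auto simp: image_subset_iff)
  have inj: "inj \<pi>" unfolding \<pi>_def by (intro inj_compose inj_transpose)
  have "\<pi> i = 1" "\<pi> j = 2" using ij(3) by (auto simp: \<pi>_def transpose_def)
  moreover note r = relabel[OF inj sub F]
  ultimately show ?thesis
    using no_large_pair_1_2[OF k r(1,2)] r(3) r(4)[of i] r(4)[of j] r(5)[of i j] big assms(9,10) by simp
qed

section \<open>A point missed by few members\<close>

text \<open>Compare \<open>A\<close> with itself: its walk from \<open>1\<close> begins with a step
  down, so it becomes positive only if the walk from \<open>2\<close> reaches height 2. Otherwise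
  some member would be disjoint from \<open>A\<close>.\<close>

lemma stable_1_hits:
  assumes "\<F> \<subseteq> nsets {1..n} k" "intersecting \<F>" "stable 1 \<F>" "A \<in> \<F>" "1 \<notin> A"
  shows "hits 2 2 A"
proof (rule ccontr)
  assume nh: "\<not> hits 2 2 A"
  have "\<not> meets 1 A A"
  proof
    assume "meets 1 A A"
    then obtain u where u: "1 \<le> u" "u - 1 < 2 * card (A \<inter> {1..<u})" by (auto simp: meets_def)
    then have "2 \<le> u" by (cases "u = 1") auto
    moreover have "A \<inter> {1..<2} = {}" using assms(5) by (auto simp: less_Suc_eq numeral_2_eq_2)
    ultimately have "card (A \<inter> {1..<u}) = card (A \<inter> {2..<u})" using card_Int_split[of 1 2 u A] by simp
    moreover have "2 * card (A \<inter> {2..<u}) < u - 2 + 2" using nh \<open>2 \<le> u\<close> unfolding hits_def by force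
    ultimately show False using u \<open>2 \<le> u\<close> by linarith
  qed
  moreover have "A \<inter> A \<inter> {..<1} = {}" "finite (A \<inter> A)"
    using subset_nsetsD[OF assms(1,4)] by auto
  ultimately have "\<exists>A'\<in>\<F>. A' \<inter> A = {}" using stable_imp_disjoint[OF assms(3,4)] by blast
  then show False using assms(2,4) by (auto simp: intersecting_def)
qed

lemma ex_small_avoiding:
  assumes k: "3 \<le> k" "36 * k < n" and "\<F> \<subseteq> nsets {1..n} k" "intersecting \<F>"
    and "card (F3 n k) < card \<F>"
  shows "\<exists>x\<in>{1..n}. card {A \<in> \<F>. x \<notin> A} \<le> 4 * ((n - 3) choose (k - 3))"
  using assms(3-)
proof (induction "\<Sum>A\<in>\<F>. \<Sum>A" arbitrary: \<F> rule: less_induct)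
  case less
  note F = less.prems(1,2) and big = less.prems(3)
  show ?case
  proof (rule ccontr)
    assume neg: "\<not> ?thesis"
    have large: "4 * ((n - 3) choose (k - 3)) < card {A \<in> \<F>. x \<notin> A}" if "x \<in> {1..n}" for x
      using neg that by (meson not_le_imp_less)
    have "\<not> stable 1 \<F>"
    proof
      assume st: "stable 1 \<F>"
      have "card (slice 2 {} \<F>) \<le> 4 * ((n - 3) choose (k - 3))"
        using card_avoiding_1_le[OF k F stable_mono[OF st] big] stable_1_hits[OF F st] by simp
      then show False using large[of 1] card_avoiding(1)[OF F(1)] k by simp
    qed
    then obtain A i j where A: "A \<in> \<F>" "j \<in> A" "i \<notin> A" "insert i (A - {j}) \<notin> \<F>"
      and ij: "1 \<le> i" "i < j"
      unfolding stable_def by blast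
    have j: "j \<in> {1..n}" using subset_nsetsD[OF F(1) A(1)] A(2) by auto
    then have i: "i \<in> {1..n}" using ij by simp
    let ?H = "shift i j \<F>"
    have H: "?H \<subseteq> nsets {1..n} k" using shift_subset_nsets[OF F(1) ij] .
    obtain x where x: "x \<in> {1..n}" "card {A \<in> ?H. x \<notin> A} \<le> 4 * ((n - 3) choose (k - 3))"
      using less.hyps[OF sum_shift_less[OF F(1) ij(2) A] H intersecting_shift[OF F(2)]] big
      by (auto simp: card_shift)
    have fixed: "B \<in> ?H" if "B \<in> \<F>" "j \<notin> B" for B
    proof -
      have "shift_set i j \<F> B = B" using that(2) by (simp add: shift_set_def)
      then show ?thesis using that(1) unfolding shift_def by (metis imageI)
    qed
    \<comment> \<open>Members without \<open>j\<close> do not move, so the count for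
      \<open>j\<close> cannot drop; for points other than \<open>i\<close> and \<open>j\<close> it
      is unchanged. Only \<open>i\<close> remains.\<close>
    have "x \<noteq> j"
    proof
      assume "x = j"
      then have "card {A \<in> \<F>. x \<notin> A} \<le> card {A \<in> ?H. x \<notin> A}"
        using fixed by (intro card_mono) (auto simp: finite_family[OF H])
      then show False using large[OF x(1)] x(2) by simp
    qed
    moreover have "x = i" if "x \<noteq> j"
    proof (rule ccontr)
      assume "x \<noteq> i"
      then have "card {A \<in> ?H. x \<notin> A} = card {A \<in> \<F>. x \<notin> A}"
        using that by (intro card_shift_Collect) (auto simp: shift_set_def)
      then show False using large[OF x(1)] x(2) by simp
    qed
    ultimately have "x = i" by simp
    have "card {A \<in> \<F>. i \<notin> A \<and> j \<notin> A} \<le> card {A \<in> ?H. i \<notin> A}"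
      using fixed by (intro card_mono) (auto simp: finite_family[OF H])
    \<comment> \<open>By the gap, more than \<open>m\<close> members miss \<open>i\<close> and
      likewise for \<open>j\<close>. The members missing both survive the shift, so their number
      contradicts the choice of \<open>x\<close>.\<close>
    moreover have "4 * ((n - 3) choose (k - 3)) < card {A \<in> \<F>. i \<notin> A \<and> j \<notin> A}"
      using card_avoiding_gap[OF k F big i] card_avoiding_gap[OF k F big j] large[OF i] large[OF j] ij
      by (intro no_large_pair[OF k F big i j]) auto
    ultimately show False using x(2) \<open>x = i\<close> by simp
  qed
qed

section \<open>The case of edges and the degree ratio\<close>

text \<open>Intersecting edges form a star or a triangle, and a triangle has only three.\<close>

lemma intersecting_edges_star:
  assumes "\<F> \<subseteq> nsets S 2" "intersecting \<F>" "3 < card \<F>"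
  shows "\<exists>x\<in>S. \<forall>A\<in>\<F>. x \<in> A"
proof -
  have fin: "finite \<F>" using assms(3) by (rule_tac ccontr) simp
  have edge: "A \<subseteq> S \<and> (\<exists>a b. A = {a, b} \<and> a \<noteq> b)" if "A \<in> \<F>" for A
    using that assms(1) by (auto simp: nsets_def card_2_iff)
  have int: "A \<inter> B \<noteq> {}" if "A \<in> \<F>" "B \<in> \<F>" for A B
    using assms(2) that by (auto simp: intersecting_def)
  obtain A where A: "A \<in> \<F>" using assms(3) by fastforce
  have "\<not> \<F> \<subseteq> {A}" using assms(3) card_mono[of "{A}" \<F>] by auto
  then obtain B where B: "B \<in> \<F>" "B \<noteq> A" by blast
  obtain a where a: "a \<in> A" "a \<in> B" using int[OF A B(1)] by auto
  obtain b where b: "A = {a, b}" "a \<noteq> b" using edge[OF A] a by auto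
  obtain c where c: "B = {a, c}" "a \<noteq> c" using edge[OF B(1)] a by auto
  have bc: "b \<noteq> c" using B(2) b c by auto
  have "a \<in> C" if C: "C \<in> \<F>" for C
  proof (rule ccontr)
    assume "a \<notin> C"
    then have "b \<in> C" "c \<in> C" using int[OF C A] int[OF C B(1)] b c by auto
    then have Ceq: "C = {b, c}" using edge[OF C] bc by auto
    have "D \<in> {A, B, C}" if D: "D \<in> \<F>" for D
    proof -
      obtain p q where "D = {p, q}" "p \<noteq> q" using edge[OF D] by blast
      then show ?thesis using int[OF D A] int[OF D B(1)] int[OF D C] b c bc Ceq by auto
    qed
    then have "card \<F> \<le> card {A, B, C}" by (intro card_mono) auto
    also have "\<dots> \<le> 3" by (simp add: card_insert_if)
    finally show False using assms(3) by simp
  qed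
  then show ?thesis using a edge[OF A] by blast
qed

lemma ex_avoiding_ratio:
  fixes n k :: nat
  assumes "2 \<le> k" "36 * k < n" and F: "\<F> \<subseteq> nsets {1..n} k" "intersecting \<F>"
    and big: "card (F3 n k) < card \<F>"
  shows "\<exists>x\<in>{1..n}. card {A \<in> \<F>. x \<notin> A} * (3 * n) < 40 * k * card \<F>"
proof (cases "k = 2")
  \<comment> \<open>Here truncated subtraction would give \<open>(n - 3) choose (k - 3)\<close> the
    value 1; \<open>F3\<close> is just a triangle.\<close>
  case True
  have "{{1, 2}, {1, 3}, {2, 3}} \<subseteq> F3 n 2" using assms(2) True by (auto simp: F3_def nsets_def)
  moreover have "F3 n 2 \<subseteq> nsets {1..n} 2" by (auto simp: F3_def)
  ultimately have "card {{1, 2}, {1, 3}, {2, 3::nat}} \<le> card (F3 n 2)"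
    by (intro card_mono finite_family)
  moreover have "card {{1, 2}, {1, 3}, {2, 3::nat}} = 3" by (auto simp: card_insert_if doubleton_eq_iff)
  ultimately have "3 < card \<F>" using big True by simp
  then obtain x where x: "x \<in> {1..n}" "\<forall>A\<in>\<F>. x \<in> A"
    using intersecting_edges_star[of \<F> "{1..n}"] F True by auto
  then have e: "{A \<in> \<F>. x \<notin> A} = {}" by auto
  have "card {A \<in> \<F>. x \<notin> A} * (3 * n) < 40 * k * card \<F>"
    unfolding e using \<open>3 < card \<F>\<close> True by simp
  then show ?thesis using x(1) by blast
next
  case False
  then have k: "3 \<le> k" using assms(1) by simp
  have kn: "k \<le> n" using assms(2) by simp
  define e where "e = (n - 3) choose (k - 3)"
  define m where "m = (n - 3) choose (k - 2)"
  note est = binomial_estimates[OF k assms(2), folded e_def m_def]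
  obtain x where x: "x \<in> {1..n}" "card {A \<in> \<F>. x \<notin> A} \<le> 4 * e"
    using ex_small_avoiding[OF k assms(2) F big] by (auto simp: e_def)
  have "card {A \<in> \<F>. x \<notin> A} * (3 * n) \<le> 12 * (e * n)" using mult_le_mono1[OF x(2), of "3 * n"] by simp
  \<comment> \<open>From \<open>36 * k < n\<close> it follows that \<open>n < 10 * (n - k)\<close>;
    below, \<open>card \<F>\<close> is bounded from below by \<open>3 * m\<close>.\<close>
  also have "\<dots> < 12 * (e * (10 * (n - k)))" using est(1) assms(2) by simp
  also have "\<dots> \<le> 120 * (k * m)" using est(2) by simp
  also have "\<dots> \<le> 40 * k * card \<F>"
    using big card_F3_ge[OF k kn] by (simp add: m_def)
  finally show ?thesis using x(1) by blast
qed

lemma degree_ratio_ge: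
  assumes "\<F> \<subseteq> nsets {1..n} k" "x \<in> {1..n}" "0 < card \<F>"
  shows "1 - real (card {A \<in> \<F>. x \<notin> A}) / real (card \<F>) \<le> degree_ratio n \<F>"
proof -
  have "link \<F> x = (\<lambda>A. A - {x}) ` {A \<in> \<F>. x \<in> A}" by (auto simp: link_def)
  moreover have "inj_on (\<lambda>A. A - {x}) {A \<in> \<F>. x \<in> A}"
    by (rule inj_onI) (metis (mono_tags, lifting) insert_Diff mem_Collect_eq)
  ultimately have l: "card (link \<F> x) = card {A \<in> \<F>. x \<in> A}" by (simp add: card_image)
  have "\<F> = {A \<in> \<F>. x \<in> A} \<union> {A \<in> \<F>. x \<notin> A}" by auto
  moreover have "{A \<in> \<F>. x \<in> A} \<inter> {A \<in> \<F>. x \<notin> A} = {}" by auto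
  ultimately have "card \<F> = card {A \<in> \<F>. x \<in> A} + card {A \<in> \<F>. x \<notin> A}"
    using finite_family[OF assms(1)] by (metis (no_types, lifting) card_Un_disjoint finite_Un)
  moreover have "card (link \<F> x) \<le> max_degree n \<F>"
    unfolding max_degree_def using assms(2) by (intro Max_ge) auto
  ultimately have "real (card \<F>) - real (card {A \<in> \<F>. x \<notin> A}) \<le> real (max_degree n \<F>)"
    using l by linarith
  then have "(real (card \<F>) - real (card {A \<in> \<F>. x \<notin> A})) / real (card \<F>) \<le> degree_ratio n \<F>"
    unfolding degree_ratio_def by (rule divide_right_mono) simp
  then show ?thesis using assms(3) by (simp add: diff_divide_distrib)
qed

text \<open>The bound for the constant 40 only weakens as \<open>c\<close> grows; a real
  \<open>c\<close> covers both \<open>max (real k + 4) 40\<close> and \<open>d\<close>.\<close>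

lemma degree_ratio_gt:
  fixes n k :: nat
  assumes "2 \<le> k" "36 * k < n" "\<F> \<subseteq> nsets {1..n} k" "intersecting \<F>"
    and "card (F3 n k) < card \<F>" "40 \<le> c"
  shows "1 - c * (real k / (3 * real n)) < degree_ratio n \<F>"
proof -
  obtain x where x: "x \<in> {1..n}" "card {A \<in> \<F>. x \<notin> A} * (3 * n) < 40 * k * card \<F>"
    using ex_avoiding_ratio[OF assms(1-5)] by blast
  have pos: "0 < real (card \<F>)" "0 < 3 * real n" using assms(2,5) by auto
  have "real (card {A \<in> \<F>. x \<notin> A}) * (3 * real n) < 40 * real k * real (card \<F>)"
    using x(2) by (metis (mono_tags, lifting) of_nat_less_iff of_nat_mult of_nat_numeral)
  then have "real (card {A \<in> \<F>. x \<notin> A}) / real (card \<F>) < 40 * (real k / (3 * real n))"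
    using pos by (simp add: field_simps)
  also have "\<dots> \<le> c * (real k / (3 * real n))" using assms(6) by (intro mult_right_mono) auto
  finally show ?thesis using degree_ratio_ge[OF assms(3) x(1)] pos by simp
qed

theorem corollary1p13:
  fixes n k :: nat and \<F> :: "nat set set"
  assumes "k \<ge> 2"
    and "n > 36 * k"
    and "\<F> \<subseteq> nsets {1..n} k"
    and "intersecting \<F>"
  shows "(card \<F> \<ge> card (F3 n k) + 1 \<longrightarrow>
            degree_ratio n \<F> > 1 - max (real k + 4) 40 * (real k / (3 * real n)))
       \<and> (\<forall>d::int. d \<ge> 40 \<longrightarrow>
            card \<F> > card (F3 n k) \<longrightarrow>
            real (card \<F>) \<ge> real (card (F3 n k))
                + real_of_int d / 2 * binom (int n - d + 3) (int k - d + 3) \<longrightarrow>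
            degree_ratio n \<F> > 1 - real_of_int d * real k / (3 * real n))"
proof (intro conjI impI allI)
  assume "card \<F> \<ge> card (F3 n k) + 1"
  then show "degree_ratio n \<F> > 1 - max (real k + 4) 40 * (real k / (3 * real n))"
    using degree_ratio_gt[of k n \<F> "max (real k + 4) 40"] assms by simp
next
  fix d :: int
  assume "d \<ge> 40" "card \<F> > card (F3 n k)"
  then show "degree_ratio n \<F> > 1 - real_of_int d * real k / (3 * real n)"
    using degree_ratio_gt[of k n \<F> "real_of_int d"] assms by simp
qed

end
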